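(* Let $n\ge6$ be an even integer. Then for every integer $m\ge1$, $$\lim_{s\to-n+1}(s+n-1)\,I_m(s)=-\frac{(n-1)_m}{\Gamma(m)}\,\frac{(\frac n2-1)_m}{(\frac n2)_m}$$ and $$\lim_{s\to-n+2}(s+n-2)\,I_m(s)=-\frac{(n-1)_m}{(2)_m}\left(\frac{m(m+1)\,n\,(\frac n2-1)(\frac n2-2)}{2\,(m+\frac n2-2)(m+\frac n2-1)(m+\frac n2)}\right).$$ In particular, $-n+1\in\mathcal{W}_1^d$ and $-n+2\in\mathcal{W}_1^d$. For $n=4$, one has $-3\in\mathcal{W}_1^d$.
   Context: $(a)_\ell=a(a+1)\cdots(a+\ell-1)$ is the Pochhammer symbol, $(a)_0=1$, and ${}_2F_1$ is the Gauss hypergeometric function. For integers $n>2$ and $m\ge0$ put $$S_m(t)=\frac{(n-1)_m}{(\frac n2)_m}\,{}_2F_1\!\left(\begin{matrix}m,\ 1-\frac n2\\ m+\frac n2\end{matrix};t\right),$$ and for $s>-1$ (or $\operatorname{Re}s>-1$) $$I_m(s)=\frac{\Gamma(\frac n2+s+1)}{\Gamma(\frac n2)\,\Gamma(s+1)}\int_0^1t^{m+\frac n2-1}(1-t)^sS_m(t)^2\,dt.$$ The function $I_m$ extends to a meromorphic function on $\mathbb{C}$, still denoted $I_m(s)$ (and $I_0\equiv1$). For $s_0\in\mathbb{C}$ and an integer $r\ge1$, let $c_{-r,m}(s_0)$ be the coefficient of $(s-s_0)^{-r}$ in the Laurent expansion of $I_m$ at $s_0$. The discrete Wallach set $\mathcal{W}_r^d$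 (depending on $n$) is the set of $s_0\in\mathbb{C}$ such that $I_m$ has a pole at $s_0$ for some $m$, the numbers $c_{-r,m}(s_0)$, $m\ge0$, are either all nonnegative or all nonpositive, and they are not all zero. *)

theory Defs
  imports "HOL-Complex_Analysis.Complex_Analysis"
begin

(* The last argument 1 of fps_hypergeo is a scaling factor of the variable. *)
definition Gauss_2F1 :: "real \<Rightarrow> real \<Rightarrow> real \<Rightarrow> real \<Rightarrow> real" where
  "Gauss_2F1 a b c t = eval_fps (fps_hypergeo [a, b] [c] 1) t"

definition S_fun :: "nat \<Rightarrow> nat \<Rightarrow> real \<Rightarrow> real" where
  "S_fun n m t = pochhammer (real n - 1) m / pochhammer (real n / 2) m *
     Gauss_2F1 (real m) (1 - real n / 2) (real m + real n / 2) t"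

(* Meaningful only for Re s > -1, where the integral converges. *)
definition I_integral :: "nat \<Rightarrow> nat \<Rightarrow> complex \<Rightarrow> complex" where
  "I_integral n m s =
     Gamma (of_nat n / 2 + s + 1) / (Gamma (of_nat n / 2) * Gamma (s + 1)) *
     integral {0..1} (\<lambda>t::real.
       of_real (t powr (real m + real n / 2 - 1)) * of_real (1 - t) powr s *
       of_real (S_fun n m t ^ 2))"

(* The meromorphic continuation. The predicate nicely_meromorphic_on normalises the values
   at isolated points (0 at poles, the limit elsewhere), which makes the extension unique
   as a total function. *)
definition I_fun :: "nat \<Rightarrow> nat \<Rightarrow> complex \<Rightarrow> complex" where
  "I_fun n m = (THE f. f nicely_meromorphic_on UNIV \<and>
     (\<forall>s. Re s > -1 \<longrightarrow> f s = I_integral n m s))"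

definition laurent_coeff :: "nat \<Rightarrow> nat \<Rightarrow> nat \<Rightarrow> complex \<Rightarrow> complex" where
  "laurent_coeff n r m s0 = fls_nth (laurent_expansion (I_fun n m) s0) (- int r)"

(* The coefficients are complex in general: "nonnegative" and "nonpositive" mean
   membership in the real half-lines nonneg_Reals and nonpos_Reals. *)
definition discrete_Wallach :: "nat \<Rightarrow> nat \<Rightarrow> complex set" where
  "discrete_Wallach n r = {s0.
     (\<exists>m. is_pole (I_fun n m) s0) \<and>
     ((\<forall>m. laurent_coeff n r m s0 \<in> \<real>\<^sub>\<ge>\<^sub>0) \<or> (\<forall>m. laurent_coeff n r m s0 \<in> \<real>\<^sub>\<le>\<^sub>0)) \<and>
     (\<exists>m. laurent_coeff n r m s0 \<noteq> 0)}"

end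

theory Submission
  imports Defs
begin

text \<open>
  Write \<open>n = 2 k + 2\<close>, so that \<open>S\<^sub>m\<close> is a polynomial of degree at most \<open>k\<close>, and expand
  \<open>t^(m+k) S\<^sub>m(t)\<^sup>2 = \<Sum>\<^sub>j w\<^sub>j (1 - t)^j\<close>. Integrating term by term gives
  \<open>I\<^sub>m(s) = (s+1)\<^sub>k\<^sub>+\<^sub>1 / k! * \<Sum>\<^sub>j w\<^sub>j / (s + j + 1)\<close>, whose residue at \<open>-j - 1\<close> is
  \<open>w\<^sub>j (-j)\<^sub>k\<^sub>+\<^sub>1 / k!\<close>; the two poles in question belong to \<open>j = 2 k\<close> and \<open>j = 2 k - 1\<close>.

  By a quadratic transformation and Clausen's formula one expects \<open>t^(m+k) S\<^sub>m(t)\<^sup>2\<close> to agree with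
  \<open>\<Sum>\<^sub>j\<^sub>\<le>\<^sub>k q\<^sub>j t^(k-j) (1 - t)^(2 j)\<close> up to order \<open>2 k\<close> at \<open>t = 1\<close>, where \<open>q\<^sub>j\<close> is a product of
  factorials. Indeed both polynomials are annihilated by the symmetric square of the hypergeometric
  operator, whose exponents at \<open>t = 1\<close> are \<open>0\<close>, \<open>2 k + 1\<close> and \<open>4 k + 2\<close>, and both take the value \<open>1\<close>
  there. As \<open>t^(k-j) (1 - t)^(2 j)\<close> has degree \<open>k + j\<close>, this leaves \<open>w\<^sub>2\<^sub>k = q\<^sub>k\<close> and
  \<open>w\<^sub>2\<^sub>k\<^sub>-\<^sub>1 = - q\<^sub>k\<^sub>-\<^sub>1\<close>.
\<close>

subsection \<open>The symmetric square of the hypergeometric operator\<close>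

definition X :: "real poly" where "X = [:0, 1:]"

text \<open>The derivation \<open>(1 - t) t d/dt\<close>. It sends each
  \<open>X ^ a * (1 - X) ^ b\<close> to a polynomial multiple of itself and vanishes at both
  singular points 0 and 1, so all operators can be handled inside the polynomial ring.\<close>

definition dY :: "real poly \<Rightarrow> real poly" where
  "dY p = (1 - X) * X * pderiv p"

text \<open>
  On \<open>p = X^k * h\<close>, \<open>nabla k\<close> acts as \<open>dY\<close> acts on \<open>h\<close>. In these terms the hypergeometric equation
  for \<open>S\<close> becomes invariant under \<open>X \<mapsto> 1/X\<close> after multiplication by \<open>X^(m/2)\<close>, and \<open>sqop\<close> is the
  third-order operator annihilating the squares of the solutions.
\<close>

definition nabla :: "nat \<Rightarrow> real poly \<Rightarrow> real poly" where
  "nabla k p = dY p - of_nat k * (1 - X) * p"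

definition sqop :: "nat \<Rightarrow> nat \<Rightarrow> real poly \<Rightarrow> real poly" where
  "sqop k m p =
     nabla k (nabla k (nabla k p)) + 3 * (X + of_nat k * (1 + X)) * nabla k (nabla k p)
     + (X * (1 + X) + of_nat k * X * (5 + 3 * X) + 2 * (of_nat k)\<^sup>2 * (1 + X)\<^sup>2
        - of_nat m * of_nat (m + 2 * k) * (1 - X)\<^sup>2) * nabla k p
     - of_nat k * of_nat m * of_nat (m + 2 * k) * (1 - X)\<^sup>2 * (1 + X) * p"

lemma poly_X [simp]: "poly X t = t"
  by (simp add: X_def)

lemma pderiv_X [simp]: "pderiv X = 1"
  by (simp add: X_def pderiv_pCons)

lemma dY_add: "dY (p + q) = dY p + dY q"
  and dY_diff: "dY (p - q) = dY p - dY q"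
  and dY_minus: "dY (- p) = - dY p"
  and dY_mult: "dY (p * q) = dY p * q + p * dY q"
  and dY_smult: "dY (smult c p) = smult c (dY p)"
  and dY_of_nat: "dY (of_nat i) = 0"
  and dY_numeral: "dY (numeral w) = 0"
  and dY_1: "dY 1 = 0"
  and dY_0: "dY 0 = 0"
  and dY_X: "dY X = (1 - X) * X"
  by (simp_all add: dY_def pderiv_add pderiv_diff pderiv_minus pderiv_mult pderiv_smult algebra_simps
      flip: smult_add_right smult_diff_right)

lemmas dY_simps = dY_add dY_diff dY_minus dY_mult dY_of_nat dY_numeral dY_1 dY_0 dY_X

lemma dY_X_power: "dY (X ^ a) = of_nat a * (1 - X) * X ^ a"
proof (induction a)
  case (Suc a)
  have "dY (X ^ Suc a) = (1 - X) * X * X ^ a + X * dY (X ^ a)"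
    by (simp add: dY_mult dY_X)
  then show ?case
    unfolding Suc by (simp add: algebra_simps)
qed (simp add: dY_1)

lemma dY_Y_power: "dY ((1 - X) ^ b) = - of_nat b * X * (1 - X) ^ b"
proof (induction b)
  case (Suc b)
  have "dY ((1 - X) ^ Suc b) = (X - 1) * X * (1 - X) ^ b + (1 - X) * dY ((1 - X) ^ b)"
    by (simp add: dY_mult dY_X dY_diff dY_1 algebra_simps)
  then show ?case
    unfolding Suc by (simp add: algebra_simps)
qed (simp add: dY_1)

lemma nabla_mult: "nabla k (p * q) = dY p * q + p * nabla k q"
  by (simp add: nabla_def dY_mult algebra_simps)

lemma nabla_add: "nabla k (p + q) = nabla k p + nabla k q"
  and nabla_diff: "nabla k (p - q) = nabla k p - nabla k q"
  and nabla_smult: "nabla k (smult c p) = smult c (nabla k p)"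
  and nabla_0: "nabla k 0 = 0"
  by (simp_all add: nabla_def dY_add dY_diff dY_smult dY_0 algebra_simps
      flip: smult_add_right smult_diff_right)

lemma sqop_diff: "sqop k m (p - q) = sqop k m p - sqop k m q"
  by (simp add: sqop_def nabla_diff algebra_simps)

lemma sqop_add: "sqop k m (p + q) = sqop k m p + sqop k m q"
  by (simp add: sqop_def nabla_add algebra_simps)

lemma sqop_smult: "sqop k m (smult c p) = smult c (sqop k m p)"
  by (simp add: sqop_def nabla_smult flip: smult_add_right smult_diff_right)

lemma sqop_sum_smult: "sqop k m (\<Sum>j\<in>A. smult (c j) (f j)) = (\<Sum>j\<in>A. smult (c j) (sqop k m (f j)))"
  by (induction A rule: infinite_finite_induct)
     (simp_all only: sum.insert sum.infinite sum.empty sqop_add sqop_smult not_False_eq_True,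
      simp_all add: sqop_def nabla_0)

lemma poly_dY_1 [simp]: "poly (dY p) 1 = 0"
  by (simp add: dY_def)

text \<open>The assumption \<open>ode\<close> is the hypergeometric equation written with
  \<open>dY\<close>. It keeps the span of \<open>S * S\<close>, \<open>S * T\<close> and
  \<open>T * T\<close>, where \<open>T = dY S\<close>, closed under differentiation, so the square
  and its first three derivatives satisfy a linear relation; \<open>sqop\<close> is that
  relation.\<close>

lemma sqop_square:
  assumes ode: "dY (dY S) = - (X + of_nat m * (1 - X) + of_nat k * (1 + X)) * dY S
                            - of_nat k * of_nat m * X * (1 - X) * S"
  shows "sqop k m (X ^ (m + k) * S\<^sup>2) = 0"
proof -
  \<comment> \<open>\<open>D\<close> is \<open>nabla k\<close> conjugated by
    \<open>X ^ (m + k)\<close>, which strips the power of \<open>X\<close> from the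
    computation.\<close>
  define D where "D p = dY p + of_nat m * (1 - X) * p" for p
  have nabla_X: "nabla k (p * X ^ (m + k)) = D p * X ^ (m + k)" for p
    unfolding nabla_mult D_def by (simp add: nabla_def dY_X_power algebra_simps)
  have comm: "X ^ (m + k) * p = p * X ^ (m + k)" for p
    by (simp add: mult.commute)
  define T where "T = dY S"
  define K M :: "real poly" where "K = of_nat k" and "M = of_nat m"
  have dT: "dY T = - (X + M * (1 - X) + K * (1 + X)) * T - K * M * X * (1 - X) * S"
    using ode by (simp add: T_def K_def M_def)
  have dS: "dY S = T"
    by (simp add: T_def)
  have dK: "dY K = 0" "dY M = 0"
    by (simp_all add: K_def M_def dY_of_nat)
  have D': "D p = dY p + M * (1 - X) * p" for p
    by (simp add: D_def M_def)
  have D1: "D (S * S) = 2 * S * T + M * (1 - X) * S * S"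
    by (simp add: D' dY_simps dS algebra_simps)
  have D2: "D (D (S * S)) = 2 * T * T + 2 * S * dY T + 4 * M * (1 - X) * S * T
       + (M * M * (1 - X) * (1 - X) - M * X * (1 - X)) * S * S"
    unfolding D1 unfolding D' by (simp add: dY_simps dS dK algebra_simps)
  \<comment> \<open>The second derivative of \<open>T\<close> comes only from
    \<open>2 * S * dY T\<close>. It is written as \<open>dY\<close> of the right-hand side of
    \<open>dT\<close>, so that one more use of \<open>dT\<close> leaves an identity in
    \<open>X\<close>, \<open>K\<close>, \<open>M\<close>, \<open>S\<close> and
    \<open>T\<close>.\<close>
  have D3: "D (D (D (S * S))) =
      (4 * T * dY T + 2 * T * dY T
       + 2 * S * dY (- (X + M * (1 - X) + K * (1 + X)) * T - K * M * X * (1 - X) * S)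
       + dY (4 * M * (1 - X) * S * T)
       + dY ((M * M * (1 - X) * (1 - X) - M * X * (1 - X)) * S * S))
       + M * (1 - X) * (2 * T * T + 2 * S * dY T + 4 * M * (1 - X) * S * T
       + (M * M * (1 - X) * (1 - X) - M * X * (1 - X)) * S * S)"
    unfolding D2 unfolding D' unfolding dT[symmetric]
    by (simp add: dY_simps dS dK algebra_simps)
  have "sqop k m (S * S * X ^ (m + k)) =
     (D (D (D (S * S))) + 3 * (X + K * (1 + X)) * D (D (S * S))
     + (X * (1 + X) + K * X * (5 + 3 * X) + 2 * K * K * (1 + X) * (1 + X)
        - M * (M + 2 * K) * (1 - X) * (1 - X)) * D (S * S)
     - K * M * (M + 2 * K) * (1 - X) * (1 - X) * (1 + X) * (S * S)) * X ^ (m + k)"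
    unfolding sqop_def nabla_X K_def M_def of_nat_add of_nat_mult of_nat_numeral power2_eq_square
    by (simp only: algebra_simps)
  also have "(D (D (D (S * S))) + 3 * (X + K * (1 + X)) * D (D (S * S))
     + (X * (1 + X) + K * X * (5 + 3 * X) + 2 * K * K * (1 + X) * (1 + X)
        - M * (M + 2 * K) * (1 - X) * (1 - X)) * D (S * S)
     - K * M * (M + 2 * K) * (1 - X) * (1 - X) * (1 + X) * (S * S)) = 0"
    unfolding D3 unfolding D2 unfolding D1 by (simp add: dY_simps dS dK dT) algebra
  finally show ?thesis
    by (simp add: power2_eq_square comm)
qed

text \<open>For \<open>k = a + j\<close> the operator \<open>nabla k\<close> multiplies the basis
  element by \<open>- j (1 + X)\<close>. The resulting factor is split into a multiple of
  \<open>(1 - X)^2\<close> and a multiple of \<open>X\<close> because \<open>(1 - X)^2\<close> times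
  element \<open>j\<close> is \<open>X\<close> times element \<open>j + 1\<close>, which turns
  \<open>sqop\<close> into a two-term recurrence.\<close>

lemma sqop_basis:
  fixes a j :: nat
  defines "k \<equiv> a + j"
  shows "sqop k m (X ^ a * (1 - X) ^ (2 * j)) =
    (1 + X) * (of_nat a * of_nat (j + m) * (of_nat j - of_nat (m + 2 * k)) * (1 - X)\<^sup>2
      - 2 * of_nat j * (2 * of_nat j - 1 - 2 * of_nat k) * (of_nat j - 1 - 2 * of_nat k) * X)
    * (X ^ a * (1 - X) ^ (2 * j))"
proof -
  define E where "E = X ^ a * (1 - X) ^ (2 * j)"
  define A J M :: "real poly" where "A = of_nat a" and "J = of_nat j" and "M = of_nat m"
  have k: "of_nat k = A + J"
    by (simp add: k_def A_def J_def)
  have dAJ: "dY A = 0" "dY J = 0"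
    by (simp_all add: A_def J_def dY_of_nat)
  have N: "nabla k E = - J * (1 + X) * E"
    unfolding E_def by (simp add: nabla_def dY_mult dY_X_power dY_Y_power k A_def J_def algebra_simps)
  have N': "nabla k (p * E) = (dY p - p * J * (1 + X)) * E" for p
    unfolding nabla_mult N by (simp add: algebra_simps)
  show ?thesis
    unfolding E_def[symmetric] sqop_def N N' of_nat_add of_nat_mult k A_def[symmetric] J_def[symmetric] M_def[symmetric] of_nat_numeral
    by (simp add: dY_simps dAJ) algebra
qed

text \<open>The indicial polynomial at \<open>X = 1\<close> is \<open>- r (r - 2 k - 1) (r - 4 k - 2)\<close>.\<close>

lemma sqop_exponents:
  assumes "sqop k m p = 0" "poly p 1 = 0"
  shows "(1 - X) ^ (2 * k + 1) dvd p"
proof (cases "p = 0")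
  case False
  define r where "r = order 1 p"
  obtain R0 where R0: "p = [:- 1, 1:] ^ r * R0" "\<not> [:- 1, 1:] dvd R0"
    using order_decomp[OF False, of 1] by (auto simp: r_def)
  define R where "R = (-1) ^ r * R0"
  have Y: "[:- 1, 1:] = (-1) * (1 - X)"
    by (simp add: X_def one_pCons)
  have p: "p = R * (1 - X) ^ r"
    unfolding R0(1) R_def Y power_mult_distrib by (simp add: mult_ac)
  have R1: "poly R 1 \<noteq> 0"
    using R0(2) by (simp add: R_def poly_eq_0_iff_dvd)
  have "r \<noteq> 0"
    using assms(2) R1 p by auto
  \<comment> \<open>\<open>D\<close> is \<open>nabla k\<close> conjugated by
    \<open>(1 - X) ^ r\<close>. As \<open>dY\<close> vanishes at 1, each \<open>D\<close> multiplies
    the value at 1 by \<open>- r\<close>, so evaluating \<open>?Z\<close> there yields the indicial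
    polynomial.\<close>
  define D where "D q = dY q - (of_nat r * X + of_nat k * (1 - X)) * q" for q
  have nab: "nabla k (q * (1 - X) ^ r) = D q * (1 - X) ^ r" for q
    unfolding nabla_mult D_def by (simp add: nabla_def dY_Y_power algebra_simps)
  have D1: "poly (D q) 1 = - real r * poly q 1" for q
    by (simp add: D_def)
  let ?Z = "D (D (D R)) + 3 * (X + of_nat k * (1 + X)) * D (D R)
     + (X * (1 + X) + of_nat k * X * (5 + 3 * X) + 2 * (of_nat k)\<^sup>2 * (1 + X)\<^sup>2
        - of_nat m * of_nat (m + 2 * k) * (1 - X)\<^sup>2) * D R
     - of_nat k * of_nat m * of_nat (m + 2 * k) * (1 - X)\<^sup>2 * (1 + X) * R"
  have "?Z * (1 - X) ^ r = 0"
    using assms(1) unfolding p sqop_def nab by (simp only: algebra_simps)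
  moreover have "1 - X \<noteq> 0"
    by (simp add: X_def one_pCons)
  ultimately have "?Z = 0"
    by simp
  hence "poly ?Z 1 = 0"
    by simp
  hence "- real r * poly R 1 * ((real r - (2 * real k + 1)) * (real r - (4 * real k + 2))) = 0"
    by (simp add: D1 algebra_simps power2_eq_square)
  with R1 \<open>r \<noteq> 0\<close> have "real r = 2 * real k + 1 \<or> real r = 4 * real k + 2"
    by auto
  hence "2 * k + 1 \<le> r"
    by linarith
  thus ?thesis
    unfolding p by (metis dvd_mult le_imp_power_dvd)
qed simp

subsection \<open>Comparison with the Clausen polynomial\<close>

definition S_poly :: "nat \<Rightarrow> nat \<Rightarrow> real poly" where
  "S_poly k m = smult (pochhammer (2 * real k + 1) m / pochhammer (real k + 1) m)
     (\<Sum>j\<le>k. monom (pochhammer (real m) j * pochhammer (- real k) j /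
                      (pochhammer (real m + real k + 1) j * fact j)) j)"

text \<open>Valid beyond the degree as well, since \<open>pochhammer (- real k) i = 0\<close> for
  \<open>i > k\<close>.\<close>

lemma coeff_S_poly:
  "coeff (S_poly k m) i = pochhammer (2 * real k + 1) m / pochhammer (real k + 1) m *
     (pochhammer (real m) i * pochhammer (- real k) i / (pochhammer (real m + real k + 1) i * fact i))"
proof -
  have "pochhammer (- real k) i = 0" if "\<not> i \<le> k"
    using that by (simp add: pochhammer_of_nat_eq_0_lemma)
  thus ?thesis
    by (auto simp: S_poly_def coeff_sum if_distrib cong: if_cong)
qed

lemma fps_S_poly:
  "fps_of_poly (S_poly k m) = fps_const (pochhammer (2 * real k + 1) m / pochhammer (real k + 1) m) *
     fps_hypergeo [real m, - real k] [real m + real k + 1] 1"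
  by (rule fps_ext) (simp add: coeff_S_poly)

lemma S_fun_eq_poly:
  "S_fun (2 * k + 2) m t = poly (S_poly k m) t"
proof -
  define c where "c = pochhammer (2 * real k + 1) m / pochhammer (real k + 1) m"
  have c: "c \<noteq> 0"
    by (simp add: c_def pochhammer_eq_0_iff)
  have "fps_hypergeo [real m, - real k] [real m + real k + 1] 1 = fps_of_poly (smult (inverse c) (S_poly k m))"
    using c by (simp add: fps_of_poly_smult fps_S_poly c_def[symmetric] mult.assoc[symmetric]
        flip: fps_const_mult)
  moreover have "1 - real (2 * k + 2) / 2 = - real k" "real m + real (2 * k + 2) / 2 = real m + real k + 1"
      "real (2 * k + 2) - 1 = 2 * real k + 1" "real (2 * k + 2) / 2 = real k + 1"
    by (simp_all add: field_simps)
  ultimately show ?thesis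
    using c unfolding S_fun_def Gauss_2F1_def by (simp only: eval_fps_of_poly) (simp add: c_def)
qed

text \<open>The ratio of consecutive coefficients is equivalent to the hypergeometric equation in
  terms of the Euler operator \<open>e\<close>; multiplying by \<open>1 - X\<close> converts
  \<open>e\<close> into \<open>dY\<close>.\<close>

lemma S_poly_ode:
  "dY (dY (S_poly k m)) = - (X + of_nat m * (1 - X) + of_nat k * (1 + X)) * dY (S_poly k m)
      - of_nat k * of_nat m * X * (1 - X) * S_poly k m"
proof -
  define S where "S = S_poly k m"
  define e where "e p = X * pderiv p" for p
  have coeff_e: "coeff (e p) i = real i * coeff p i" for p i
    by (cases i) (auto simp: e_def X_def coeff_pderiv)
  have rec: "real (Suc i) * (real (Suc i) + real m + real k) * coeff S (Suc i)
               = (real i + real m) * (real i - real k) * coeff S i" for i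
  proof -
    have "pochhammer (real m + real k + 1) i \<noteq> 0" "real m + real k + 1 + real i \<noteq> 0"
      by (auto simp: pochhammer_eq_0_iff add_eq_0_iff)
    thus ?thesis
      by (simp add: S_def coeff_S_poly pochhammer_Suc divide_simps) (simp add: algebra_simps)
  qed
  have "e (e S) + of_nat (m + k) * e S - X * (e (e S) + of_nat m * e S - of_nat k * e S - of_nat (k * m) * S) = 0"
  proof (rule poly_eqI)
    fix i
    show "coeff (e (e S) + of_nat (m + k) * e S
        - X * (e (e S) + of_nat m * e S - of_nat k * e S - of_nat (k * m) * S)) i = coeff 0 i"
    proof (cases i)
      case (Suc j)
      thus ?thesis
        using rec[of j]
        by (simp add: X_def of_nat_poly coeff_e del: of_nat_Suc) (simp add: algebra_simps)
    qed (simp add: X_def of_nat_poly coeff_e)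
  qed
  hence *: "(1 - X) * (e (e S) + of_nat (m + k) * e S - X * (e (e S) + of_nat m * e S - of_nat k * e S - of_nat (k * m) * S)) = 0"
    by simp
  have dY_e: "dY p = (1 - X) * e p" for p
    by (simp add: dY_def e_def mult.assoc)
  have "dY (dY S) = (1 - X) * ((1 - X) * e (e S)) - (1 - X) * X * e S"
    by (subst dY_e) (simp add: dY_mult dY_diff dY_1 dY_X, simp add: dY_e algebra_simps)
  thus ?thesis
    using * unfolding S_def[symmetric] dY_e of_nat_add of_nat_mult by algebra
qed

text \<open>By Chu-Vandermonde the series at 1 is
  \<open>(k+1)_k / (m+k+1)_k = (k+1)_m / (2k+1)_m\<close>, the reciprocal of the normalising
  factor.\<close>

lemma poly_S_poly_1: "poly (S_poly k m) 1 = 1"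
proof -
  have nz: "pochhammer (real i + 1) j \<noteq> 0" for i j
    by (simp add: pochhammer_eq_0_iff)
  have "(\<Sum>j=0..k. pochhammer (real m) j * pochhammer (- real k) j /
             (of_nat (fact j) * pochhammer (real m + real k + 1) j))
      = pochhammer (real m + real k + 1 - real m) k / pochhammer (real m + real k + 1) k"
    by (rule Vandermonde_pochhammer) (auto simp: add_eq_0_iff)
  also have "real m + real k + 1 - real m = real k + 1"
    by simp
  also have "pochhammer (real k + 1) k / pochhammer (real m + real k + 1) k =
             pochhammer (real k + 1) m / pochhammer (2 * real k + 1) m"
  proof -
    have "pochhammer (real k + 1) k * pochhammer (real k + 1 + real k) m =
          pochhammer (real k + 1) m * pochhammer (real k + 1 + real m) k"
      unfolding pochhammer_product'[symmetric] by (simp add: add.commute)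
    moreover have "pochhammer (real m + real k + 1) k \<noteq> 0" "pochhammer (2 * real k + 1) m \<noteq> 0"
      using nz[of "m + k" k] nz[of "2 * k" m] by simp_all
    ultimately show ?thesis
      by (simp add: divide_simps algebra_simps)
  qed
  finally show ?thesis
    using nz[of k m] nz[of "2 * k" m]
    by (simp add: S_poly_def poly_sum poly_monom atLeast0AtMost mult.commute)
qed

text \<open>
  Up to the factor \<open>(-1/4)^j\<close>, these are the coefficients of the terminating series
  \<open>\<^sub>3F\<^sub>2(m, -2k-m, -k; -2k, 1/2-k; x)\<close> that Clausen's formula yields at \<open>x = - (1-t)\<^sup>2 / (4 t)\<close>.
\<close>

definition clausen_coeff :: "nat \<Rightarrow> nat \<Rightarrow> nat \<Rightarrow> real" where
  "clausen_coeff k m j = (-1) ^ j * pochhammer (real m) j * fact (m + 2 * k) / fact (m + 2 * k - j)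
     * ((fact k)\<^sup>2 * fact (2 * k - 2 * j) * fact (2 * k - j))
     / ((fact (k - j))\<^sup>2 * (fact (2 * k))\<^sup>2 * fact j)"

text \<open>The recurrence that \<open>sqop_basis\<close> demands: the \<open>(1 - X)^2\<close> part
  from index \<open>j\<close> must cancel the \<open>X\<close> part from index
  \<open>j + 1\<close>.\<close>

lemma clausen_coeff_Suc:
  assumes "j < k"
  shows "clausen_coeff k m j * (real (k - j) * real (j + m) * (real j - real (m + 2 * k)))
       = clausen_coeff k m (Suc j) * (2 * real (Suc j) * (2 * real (Suc j) - 1 - 2 * real k)
            * (real (Suc j) - 1 - 2 * real k))"
proof -
  \<comment> \<open>Writing \<open>k\<close> as \<open>a + j + 1\<close> removes every truncated
    subtraction from the factorials.\<close>
  obtain a where k: "k = Suc (a + j)"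
    using assms less_iff_Suc_add by (metis add.commute)
  have e: "k - j = Suc a" "k - Suc j = a" "2 * k - 2 * j = Suc (Suc (2 * a))" "2 * k - 2 * Suc j = 2 * a"
      "2 * k - j = Suc (2 * a + j + 1)" "2 * k - Suc j = 2 * a + j + 1"
      "m + 2 * k - j = Suc (m + 2 * a + j + 1)" "m + 2 * k - Suc j = m + 2 * a + j + 1"
    by (simp_all add: k)
  have nz: "2 + real m + 2 * real a + real j \<noteq> 0" "2 + 2 * real a + real j \<noteq> 0"
      "1 + real a \<noteq> 0" "1 + real j \<noteq> 0"
    by (simp_all add: add_eq_0_iff)
  define p r s x y z where "p = real m + 2 * real a + real j + 2" and "r = real a + 1"
    and "s = real j + 1" and "x = 2 * real a + 1" and "y = 2 * real a + real j + 2" and "z = real m + real j"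
  have "p \<noteq> 0" "r \<noteq> 0" "s \<noteq> 0"
    by (simp_all add: p_def r_def s_def add_eq_0_iff)
  \<comment> \<open>\<open>F\<close> is the common factor of the two consecutive coefficients; what
    remains is rational in \<open>m\<close>, \<open>a\<close> and \<open>j\<close>.\<close>
  define F where "F = fact (m + 2 * k) * (fact k)\<^sup>2 / (fact (2 * k))\<^sup>2 * ((-1) ^ j * pochhammer (real m) j
       * (fact (2 * a) * fact (2 * a + j + 1)) / (fact (m + 2 * a + j + 1) * (fact a)\<^sup>2 * fact j))"
  have "clausen_coeff k m j = F * (real (Suc (Suc (2 * a))) * real (Suc (2 * a)) * real (Suc (2 * a + j + 1)))
       / (real (Suc (m + 2 * a + j + 1)) * (real (Suc a))\<^sup>2)"
    unfolding clausen_coeff_def e F_def fact_Suc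
    by (simp add: field_simps power2_eq_square del: of_nat_Suc of_nat_add of_nat_mult)
  hence c0: "clausen_coeff k m j = F * (2 * r * x * y) / (p * r\<^sup>2)"
    by (simp add: p_def r_def x_def y_def algebra_simps)
  have "clausen_coeff k m (Suc j) = - F * (m + j) / (j + 1)"
    unfolding clausen_coeff_def e F_def fact_Suc pochhammer_Suc using nz
    by (simp add: divide_simps power2_eq_square)
  hence c1: "clausen_coeff k m (Suc j) = - F * z / s"
    by (simp add: z_def s_def algebra_simps)
  have e': "real j - real (m + 2 * k) = - p" "2 * real (Suc j) - 1 - 2 * real k = - x"
      "real (Suc j) - 1 - 2 * real k = - y" "real (k - j) = r" "real (j + m) = z" "real (Suc j) = s"
    by (simp_all add: k p_def r_def s_def x_def y_def z_def)
  show ?thesis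
    unfolding c0 c1 e'(1-5) unfolding e'(6) using \<open>p \<noteq> 0\<close> \<open>r \<noteq> 0\<close> \<open>s \<noteq> 0\<close>
    by (simp add: field_simps power2_eq_square)
qed

definition clausen_poly :: "nat \<Rightarrow> nat \<Rightarrow> real poly" where
  "clausen_poly k m = (\<Sum>j\<le>k. smult (clausen_coeff k m j) (X ^ (k - j) * (1 - X) ^ (2 * j)))"

lemma sqop_clausen_poly: "sqop k m (clausen_poly k m) = 0"
proof -
  define a where "a j = real (k - j) * real (j + m) * (real j - real (m + 2 * k))" for j
  define b where "b j = 2 * real j * (2 * real j - 1 - 2 * real k) * (real j - 1 - 2 * real k)" for j
  define E where "E j = X ^ (k - j) * (1 - X) ^ (2 * j)" for j
  let ?c = "clausen_coeff k m"
  have shift: "(1 - X)\<^sup>2 * E j = X * E (Suc j)" if "j < k" for j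
  proof -
    obtain d where d: "k - j = Suc d"
      using \<open>j < k\<close> by (metis Suc_diff_Suc)
    hence "k - Suc j = d"
      by simp
    thus ?thesis
      by (simp add: E_def d power2_eq_square mult_ac)
  qed
  have basis: "sqop k m (E j) = (1 + X) * (smult (a j) ((1 - X)\<^sup>2 * E j) - smult (b j) (X * E j))"
    if "j \<le> k" for j
  proof -
    have "sqop k m (E j) =
      (1 + X) * (of_nat (k - j) * of_nat (j + m) * (of_nat j - of_nat (m + 2 * k)) * (1 - X)\<^sup>2
      - 2 * of_nat j * (2 * of_nat j - 1 - 2 * of_nat k) * (of_nat j - 1 - 2 * of_nat k) * X) * E j"
      using sqop_basis[of "k - j" j m] that by (simp add: E_def)
    also have "of_nat (k - j) * of_nat (j + m) * (of_nat j - of_nat (m + 2 * k)) = [:a j:]"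
      by (simp add: a_def of_nat_poly)
    also have "2 * of_nat j * (2 * of_nat j - 1 - 2 * of_nat k) * (of_nat j - 1 - 2 * of_nat k) = [:b j:]"
      by (simp add: b_def of_nat_poly numeral_poly one_pCons algebra_simps)
    finally show ?thesis
      by (simp add: algebra_simps)
  qed
  have "sqop k m (clausen_poly k m) = (\<Sum>j\<le>k. smult (?c j) (sqop k m (E j)))"
    by (simp add: clausen_poly_def sqop_sum_smult E_def)
  also have "\<dots> = (\<Sum>j\<le>k. smult (?c j) ((1 + X) * (smult (a j) ((1 - X)\<^sup>2 * E j) - smult (b j) (X * E j))))"
    by (intro sum.cong refl) (simp only: basis atMost_iff)
  also have "\<dots> = (1 + X) * ((\<Sum>j\<le>k. smult (?c j * a j) ((1 - X)\<^sup>2 * E j)) - (\<Sum>j\<le>k. smult (?c j * b j) (X * E j)))"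
    unfolding sum_subtractf[symmetric] sum_distrib_left by (simp add: smult_diff_right algebra_simps)
  \<comment> \<open>The sums telescope because both boundary terms vanish: \<open>a k = 0\<close>
    here, and \<open>b 0 = 0\<close> after the index shift.\<close>
  also have "(\<Sum>j\<le>k. smult (?c j * a j) ((1 - X)\<^sup>2 * E j)) = (\<Sum>j<k. smult (?c j * a j) ((1 - X)\<^sup>2 * E j))"
    unfolding lessThan_Suc_atMost[symmetric] sum.lessThan_Suc by (simp add: a_def)
  also have "\<dots> = (\<Sum>j<k. smult (?c (Suc j) * b (Suc j)) (X * E (Suc j)))"
    by (intro sum.cong refl) (simp only: lessThan_iff shift a_def b_def clausen_coeff_Suc)
  also have "\<dots> = (\<Sum>j\<le>k. smult (?c j * b j) (X * E j))"
    by (simp add: lessThan_Suc_atMost[symmetric] sum.lessThan_Suc_shift b_def del: sum.lessThan_Suc)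
  finally show ?thesis
    by simp
qed

lemma poly_clausen_poly_1: "poly (clausen_poly k m) 1 = 1"
proof -
  have "poly (clausen_poly k m) 1 = (\<Sum>j\<le>k. clausen_coeff k m j * 0 ^ (2 * j))"
    by (simp add: clausen_poly_def poly_sum)
  also have "\<dots> = (\<Sum>j\<le>k. if j = 0 then clausen_coeff k m 0 else 0)"
    by (intro sum.cong) auto
  also have "\<dots> = 1"
    by (simp add: clausen_coeff_def power2_eq_square)
  finally show ?thesis .
qed

section \<open>Expansion of the integrand at t = 1\<close>

definition W_poly :: "nat \<Rightarrow> nat \<Rightarrow> real poly" where
  "W_poly k m = X ^ (m + k) * (S_poly k m)\<^sup>2"

text \<open>Composition with \<open>[:1, -1:]\<close> substitutes \<open>1 - t\<close> for
  \<open>t\<close>, so these are the coefficients \<open>w_j\<close> of the powers of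
  \<open>1 - t\<close>.\<close>

definition W_coeff :: "nat \<Rightarrow> nat \<Rightarrow> nat \<Rightarrow> real" where
  "W_coeff k m = coeff (W_poly k m \<circ>\<^sub>p [:1, -1:])"

lemma pcompose_power: "(p ^ n) \<circ>\<^sub>p q = (p \<circ>\<^sub>p q) ^ n"
  by (induction n) (simp_all add: pcompose_mult pcompose_1)

lemma W_coeff_eq_clausen:
  assumes "i \<le> 2 * k"
  shows "W_coeff k m i = coeff (clausen_poly k m \<circ>\<^sub>p [:1, -1:]) i"
proof -
  have "(1 - X) ^ (2 * k + 1) dvd W_poly k m - clausen_poly k m"
  proof (rule sqop_exponents)
    show "sqop k m (W_poly k m - clausen_poly k m) = 0"
      by (simp add: sqop_diff sqop_clausen_poly W_poly_def sqop_square[OF S_poly_ode])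
    show "poly (W_poly k m - clausen_poly k m) 1 = 0"
      by (simp add: poly_clausen_poly_1 W_poly_def poly_S_poly_1)
  qed
  then obtain R where R: "W_poly k m = clausen_poly k m + (1 - X) ^ (2 * k + 1) * R"
    by (metis dvdE add_diff_cancel_left' diff_add_cancel add.commute)
  have "(1 - X) \<circ>\<^sub>p [:1, -1:] = monom 1 1"
    by (simp add: X_def one_pCons pcompose_pCons monom_altdef)
  hence "W_poly k m \<circ>\<^sub>p [:1, -1:] = clausen_poly k m \<circ>\<^sub>p [:1, -1:] + monom 1 (2 * k + 1) * (R \<circ>\<^sub>p [:1, -1:])"
    unfolding R by (simp only: pcompose_add pcompose_mult pcompose_power monom_power power_one mult_1)
  thus ?thesis
    using assms by (simp add: W_coeff_def coeff_monom_mult)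
qed

lemma clausen_poly_reflect:
  "clausen_poly k m \<circ>\<^sub>p [:1, -1:] =
     (\<Sum>j\<le>k. smult (clausen_coeff k m j) (monom 1 (2 * j) * [:1, -1:] ^ (k - j)))"
proof -
  have "X \<circ>\<^sub>p [:1, -1:] = [:1, -1:]" "(1 - X) \<circ>\<^sub>p [:1, -1:] = monom 1 1"
    by (simp_all add: X_def one_pCons pcompose_pCons monom_altdef)
  thus ?thesis
    by (simp add: clausen_poly_def pcompose_sum pcompose_smult pcompose_mult pcompose_power monom_power mult.commute)
qed

lemma degree_Y_power: "degree ([:1, -1::real:] ^ i) \<le> i"
  using degree_power_le[of "[:1, -1::real:]" i] by simp

text \<open>After reflection term \<open>j\<close> is a multiple of
  \<open>X^(2j) (1 - X)^(k-j)\<close>, of degree at most \<open>k + j\<close>; only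
  \<open>j = k\<close> reaches degree \<open>2k\<close>.\<close>

lemma W_coeff_top: "W_coeff k m (2 * k) = clausen_coeff k m k"
proof -
  have "W_coeff k m (2 * k) = (\<Sum>j\<le>k. clausen_coeff k m j * coeff ([:1, -1:] ^ (k - j)) (2 * k - 2 * j))"
    by (simp add: W_coeff_eq_clausen clausen_poly_reflect coeff_sum coeff_monom_mult)
  also have "\<dots> = (\<Sum>j\<in>{k}. clausen_coeff k m j * coeff ([:1, -1:] ^ (k - j)) (2 * k - 2 * j))"
  proof (intro sum.mono_neutral_right ballI)
    fix j assume "j \<in> {..k} - {k}"
    hence "coeff ([:1, -1::real:] ^ (k - j)) (2 * k - 2 * j) = 0"
      by (intro coeff_eq_0 le_less_trans[OF degree_Y_power]) auto
    thus "clausen_coeff k m j * coeff ([:1, -1:] ^ (k - j)) (2 * k - 2 * j) = 0"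
      by simp
  qed auto
  finally show ?thesis
    by simp
qed

text \<open>Terms with \<open>j < k - 1\<close> have too small a degree, and \<open>j = k\<close> is
  a multiple of \<open>X^(2k)\<close>. What is left is \<open>X^(2k-2) (1 - X)\<close>, whose
  leading coefficient gives the minus sign.\<close>

lemma W_coeff_second:
  assumes "k \<ge> 1"
  shows "W_coeff k m (2 * k - 1) = - clausen_coeff k m (k - 1)"
proof -
  define f where "f j = clausen_coeff k m j * (if 2 * k - 1 < 2 * j then 0 else coeff ([:1, -1:] ^ (k - j)) (2 * k - 1 - 2 * j))" for j
  have "W_coeff k m (2 * k - 1) = (\<Sum>j\<le>k. f j)"
    unfolding f_def by (subst W_coeff_eq_clausen) (simp_all add: clausen_poly_reflect coeff_sum coeff_monom_mult cong: if_cong)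
  also have "\<dots> = (\<Sum>j\<in>{k - 1}. f j)"
  proof (intro sum.mono_neutral_right ballI)
    fix j assume j: "j \<in> {..k} - {k - 1}"
    show "f j = 0"
    proof (cases "j = k")
      case False
      hence "coeff ([:1, -1::real:] ^ (k - j)) (2 * k - 1 - 2 * j) = 0"
        using j by (intro coeff_eq_0 le_less_trans[OF degree_Y_power]) auto
      thus ?thesis
        by (simp add: f_def)
    qed (use assms in \<open>simp add: f_def\<close>)
  qed auto
  also have "\<dots> = - clausen_coeff k m (k - 1)"
  proof -
    have "k - (k - 1) = 1" "2 * k - 1 - 2 * (k - 1) = 1"
      using assms by auto
    thus ?thesis by (simp add: f_def)
  qed
  finally show ?thesis .
qed

section \<open>Closed forms of the two residues\<close>

lemma pochhammer_neg_nat: "j \<le> n \<Longrightarrow> pochhammer (- real n) j = (-1) ^ j * fact n / fact (n - j)"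
proof (induction j)
  case (Suc j)
  have "fact (n - j) = real (n - j) * fact (n - Suc j)"
    using Suc.prems by (subst fact_reduce) auto
  with Suc show ?case
    by (simp add: pochhammer_Suc divide_simps) (simp add: of_nat_diff algebra_simps)
qed simp

lemma pochhammer_nat_plus_1: "pochhammer (real a + 1) i = fact (a + i) / fact a"
  by (induction i) (simp_all add: pochhammer_Suc add_ac mult.commute)

text \<open>The signs \<open>(-1)^k\<close> and \<open>(-1)^(k+1)\<close> of the two factors combine
  to \<open>-1\<close> for every \<open>k\<close>. The right-hand side shows the sign uniformly in
  \<open>m\<close> and the vanishing at \<open>m = 0\<close>.\<close>

lemma residue_top:
  assumes "k \<ge> 1"
  shows "W_coeff k m (2 * k) * pochhammer (- real (2 * k)) (k + 1) / fact k =
    - (pochhammer (real m) (2 * k + 1) * real k / ((real m + real k) * fact (2 * k)))"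
proof -
  obtain l where k: "k = Suc l"
    using assms by (cases k) auto
  \<comment> \<open>The middle factor \<open>m + k\<close> is split off because the residue lacks
    it.\<close>
  have "pochhammer (real m) (k + Suc k) = pochhammer (real m) k * ((real m + k) * pochhammer (real (m + k) + 1) k)"
    unfolding pochhammer_product' by (simp add: pochhammer_rec)
  also have "pochhammer (real (m + k) + 1) k = fact (m + 2 * k) / fact (m + k)"
    by (subst pochhammer_nat_plus_1) (simp add: mult_2 add.assoc)
  finally have 1: "pochhammer (real m) (2 * k + 1) = pochhammer (real m) k * (real m + k) * (fact (m + 2 * k) / fact (m + k))"
    by (simp add: mult_2 add_ac)
  have 2: "pochhammer (- real (2 * k)) (k + 1) = (-1) ^ (k + 1) * fact (2 * k) / fact l"
    by (subst pochhammer_neg_nat) (auto simp: k)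
  have 3: "W_coeff k m (2 * k) = (-1) ^ k * pochhammer (real m) k * fact (m + 2 * k) / fact (m + k)
      * (fact k)\<^sup>2 / (fact (2 * k))\<^sup>2"
  proof -
    have e: "m + 2 * k - k = m + k" "2 * k - 2 * k = 0" "2 * k - k = k" "k - k = 0"
      by simp_all
    show ?thesis
      unfolding W_coeff_top clausen_coeff_def e by simp
  qed
  have 4: "fact k = real k * fact l"
    by (simp add: k)
  have nz: "real m + real k \<noteq> 0" "real k \<noteq> 0"
    by (simp_all add: k add_eq_0_iff)
  have sgn: "(-1 :: real) ^ k * (-1) ^ k = 1"
    by (simp flip: power_mult_distrib)
  have "W_coeff k m (2 * k) * pochhammer (- real (2 * k)) (k + 1) / fact k =
     - (((-1) ^ k * (-1) ^ k) * pochhammer (real m) k * fact (m + 2 * k) / fact (m + k) * real k / fact (2 * k))"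
    unfolding 2 3 unfolding 4 using nz by (simp add: divide_simps power2_eq_square)
  also have "\<dots> = - (pochhammer (real m) (2 * k + 1) * real k / ((real m + real k) * fact (2 * k)))"
    unfolding sgn 1 using nz by (simp add: divide_simps)
  finally show ?thesis .
qed

text \<open>Here the three middle factors of \<open>(m)_(2k+1)\<close> are missing. For
  \<open>k = 1\<close> the factor \<open>pochhammer (- 1) 2\<close> is zero, so in dimension 4 this
  residue vanishes.\<close>

lemma residue_second:
  assumes "k \<ge> 2"
  shows "W_coeff k m (2 * k - 1) * pochhammer (- real (2 * k - 1)) (k + 1) / fact k =
    - (pochhammer (real m) (2 * k + 1) * real k * (real k + 1) * (real k - 1)
      / ((real m + real k - 1) * (real m + real k) * (real m + real k + 1) * fact (2 * k)))"
proof -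
  obtain l where k: "k = Suc (Suc l)"
    using assms by (metis add_2_eq_Suc le_Suc_ex)
  define a b c where "a = real m + real k - 1" and "b = real m + real k" and "c = real m + real k + 1"
  have "pochhammer (real m) (Suc l + Suc (Suc (Suc (Suc l)))) =
     pochhammer (real m) (Suc l) * (a * (b * (c * pochhammer (real (m + k + 1) + 1) (Suc l))))"
    unfolding pochhammer_product' by (simp only: pochhammer_rec) (simp add: a_def b_def c_def k add_ac)
  also have "pochhammer (real (m + k + 1) + 1) (Suc l) = fact (m + 2 * k) / fact (m + k + 1)"
  proof -
    have "m + k + 1 + Suc l = m + 2 * k"
      by (simp add: k)
    thus ?thesis
      by (simp only: pochhammer_nat_plus_1)
  qed
  also have "Suc l + Suc (Suc (Suc (Suc l))) = 2 * k + 1"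
    by (simp add: k)
  finally have 1: "pochhammer (real m) (2 * k + 1) = pochhammer (real m) (Suc l) * a * b * c * (fact (m + 2 * k) / fact (m + k + 1))"
    by (simp only: mult.assoc)
  have 2: "pochhammer (- real (2 * k - 1)) (k + 1) = (-1) ^ (k + 1) * fact (2 * k - 1) / fact l"
    by (subst pochhammer_neg_nat) (auto simp: k)
  have "W_coeff k m (2 * k - 1) = - clausen_coeff k m (Suc l)"
    using W_coeff_second[of k m] by (simp add: k)
  also have "\<dots> = (-1) ^ k * pochhammer (real m) (Suc l) * fact (m + 2 * k) / fact (m + k + 1)
     * (fact k)\<^sup>2 * 2 * fact (k + 1) / ((fact (2 * k))\<^sup>2 * fact (Suc l))"
  proof -
    have e: "m + 2 * k - Suc l = m + k + 1" "2 * k - 2 * Suc l = 2" "2 * k - Suc l = k + 1" "k - Suc l = 1"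
      by (simp_all add: k)
    show ?thesis
      unfolding clausen_coeff_def e by (simp add: k)
  qed
  finally have 3: "W_coeff k m (2 * k - 1) = (-1) ^ k * pochhammer (real m) (Suc l) * fact (m + 2 * k) / fact (m + k + 1)
     * (fact k)\<^sup>2 * 2 * fact (k + 1) / ((fact (2 * k))\<^sup>2 * fact (Suc l))" .
  have 4: "fact (2 * k) = 2 * real k * fact (2 * k - 1)"
    by (subst fact_reduce) (auto simp: k)
  have 5: "fact (k + 1) = (real k + 1) * real k * (real k - 1) * fact l" "fact (Suc l) = (real k - 1) * fact l"
      "fact k = real k * ((real k - 1) * fact l)"
    by (simp_all add: k algebra_simps)
  have nz: "a \<noteq> 0" "b \<noteq> 0" "c \<noteq> 0" "real k \<noteq> 0" "real k - 1 \<noteq> 0"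
    by (simp_all add: k a_def b_def c_def add_eq_0_iff)
  have sgn: "(-1 :: real) ^ k * (-1) ^ k = 1"
    by (simp flip: power_mult_distrib)
  have "W_coeff k m (2 * k - 1) * pochhammer (- real (2 * k - 1)) (k + 1) / fact k =
     - (((-1) ^ k * (-1) ^ k) * pochhammer (real m) (Suc l) * fact (m + 2 * k) / fact (m + k + 1)
     * real k * (real k + 1) * (real k - 1) / fact (2 * k))"
    unfolding 2 3 unfolding 4 5 using nz by (simp add: divide_simps power2_eq_square)
  also have "\<dots> = - (pochhammer (real m) (2 * k + 1) * real k * (real k + 1) * (real k - 1) / (a * b * c * fact (2 * k)))"
    unfolding sgn 1 using nz by (simp add: divide_simps)
  finally show ?thesis
    by (simp add: a_def b_def c_def)
qed

subsection \<open>The meromorphic continuation\<close>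

text \<open>The antiderivative is \<open>- (1 - t)^(s+j+1) / (s+j+1)\<close>. The integrand may be
  singular at \<open>t = 1\<close>, so the fundamental theorem is used in the form that needs
  derivatives only in the interior and continuity up to the boundary.\<close>

lemma has_integral_one_minus_powr:
  fixes s :: complex
  assumes "Re s > -1"
  shows "((\<lambda>t::real. of_real (1 - t) powr s * of_real (1 - t) ^ j) has_integral 1 / (s + of_nat j + 1)) {0..1}"
proof -
  define z where "z = s + of_nat j + 1"
  have z: "Re z > 0" "z \<noteq> 0"
    using assms by (auto simp: z_def complex_eq_iff)
  define F where "F = (\<lambda>t::real. - (of_real (1 - t) powr z) / z)"
  have "((\<lambda>t::real. of_real (1 - t) powr s * of_real (1 - t) ^ j) has_integral F 1 - F 0) {0..1}"
  proof (rule fundamental_theorem_of_calculus_interior)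
    show "continuous_on {0..1} F"
      unfolding F_def by (intro continuous_intros) (use z in auto)
    fix t :: real assume t: "t \<in> {0<..<1}"
    have "((\<lambda>w::complex. - ((1 - w) powr z) / z) has_field_derivative (1 - of_real t) powr (z - 1)) (at (of_real t))"
      using t z by (auto intro!: derivative_eq_intros simp: complex_nonpos_Reals_iff)
    hence "((\<lambda>x. - ((1 - of_real x :: complex) powr z) / z) has_vector_derivative (1 - of_real t) powr (z - 1)) (at t)"
      by (rule has_vector_derivative_real_field)
    moreover have "(1 - of_real t :: complex) powr (z - 1) = of_real (1 - t) powr s * of_real (1 - t) ^ j"
    proof -
      have "(of_real (1 - t) :: complex) powr (s + of_nat j) = of_real (1 - t) powr s * of_real (1 - t) powr of_nat j"
        by (rule powr_add)
      thus ?thesis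
        using t by (simp add: z_def powr_nat)
    qed
    ultimately show "(F has_vector_derivative of_real (1 - t) powr s * of_real (1 - t) ^ j) (at t)"
      by (simp add: F_def)
  qed simp
  moreover have "F 1 - F 0 = 1 / (s + of_nat j + 1)"
    by (simp add: F_def z_def)
  ultimately show ?thesis
    by simp
qed

text \<open>
  At \<open>s = - j - 1\<close> the convention \<open>x / 0 = 0\<close> makes the value junk even where the singularity is
  removable; hence the continuation is \<open>remove_sings (I_rat k m)\<close>.
\<close>

definition I_rat :: "nat \<Rightarrow> nat \<Rightarrow> complex \<Rightarrow> complex" where
  "I_rat k m s = pochhammer (s + 1) (k + 1) / fact k *
     (\<Sum>j\<le>degree (W_poly k m \<circ>\<^sub>p [:1, -1:]). of_real (W_coeff k m j) / (s + of_nat j + 1))"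

lemma I_integral_eq_rat:
  assumes "Re s > -1" and "m + k > 0"
  shows "I_integral (2 * k + 2) m s = I_rat k m s"
proof -
  define P where "P = W_poly k m \<circ>\<^sub>p [:1, -1:]"
  have half: "real (2 * k + 2) / 2 = real k + 1" "(of_nat (2 * k + 2) :: complex) / 2 = of_nat k + 1"
    by (simp_all add: field_simps)
  have integrand: "of_real (t powr (real m + real (2 * k + 2) / 2 - 1)) * of_real (1 - t) powr s * of_real (S_fun (2 * k + 2) m t ^ 2)
      = (\<Sum>j\<le>degree P. of_real (W_coeff k m j) * (of_real (1 - t) powr s * of_real (1 - t) ^ j))"
    if "t \<in> {0..1}" for t :: real
  proof -
    have "t powr (real m + (real k + 1) - 1) = t powr real (m + k)"
      by (simp add: algebra_simps)
    \<comment> \<open>At \<open>t = 0\<close> the conventions \<open>0 powr 0 = 0\<close> and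
      \<open>0 ^ 0 = 1\<close> differ, hence the requirement \<open>m + k > 0\<close>.\<close>
    also have "\<dots> = t ^ (m + k)"
      using that assms(2) by (subst powr_realpow') auto
    finally have "t powr (real m + (real k + 1) - 1) * S_fun (2 * k + 2) m t ^ 2 = poly (W_poly k m) t"
      by (simp only: W_poly_def S_fun_eq_poly poly_mult poly_power poly_X)
    also have "\<dots> = poly P (1 - t)"
      by (simp add: P_def poly_pcompose)
    also have "\<dots> = (\<Sum>j\<le>degree P. W_coeff k m j * (1 - t) ^ j)"
      by (simp add: poly_altdef W_coeff_def P_def)
    finally have eq: "t powr (real m + (real k + 1) - 1) * S_fun (2 * k + 2) m t ^ 2
        = (\<Sum>j\<le>degree P. W_coeff k m j * (1 - t) ^ j)" .
    have "of_real (t powr (real m + (real k + 1) - 1)) * (of_real (S_fun (2 * k + 2) m t ^ 2) :: complex)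
        = of_real (\<Sum>j\<le>degree P. W_coeff k m j * (1 - t) ^ j)"
      unfolding eq[symmetric] by simp
    hence "of_real (1 - t) powr s * (of_real (t powr (real m + (real k + 1) - 1)) * (of_real (S_fun (2 * k + 2) m t ^ 2) :: complex))
        = of_real (1 - t) powr s * of_real (\<Sum>j\<le>degree P. W_coeff k m j * (1 - t) ^ j)"
      by simp
    thus ?thesis
      unfolding half by (simp add: sum_distrib_left mult_ac)
  qed
  have "((\<lambda>t::real. \<Sum>j\<le>degree P. of_real (W_coeff k m j) * (of_real (1 - t) powr s * of_real (1 - t) ^ j))
      has_integral (\<Sum>j\<le>degree P. of_real (W_coeff k m j) * (1 / (s + of_nat j + 1)))) {0..1}"
    by (intro has_integral_sum has_integral_mult_right has_integral_one_minus_powr assms) auto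
  hence "integral {0..1} (\<lambda>t::real. of_real (t powr (real m + real (2 * k + 2) / 2 - 1)) * of_real (1 - t) powr s * of_real (S_fun (2 * k + 2) m t ^ 2))
     = (\<Sum>j\<le>degree P. of_real (W_coeff k m j) / (s + of_nat j + 1))"
    by (subst integral_cong[OF integrand]) (auto simp: integral_unique)
  moreover have "Gamma (of_nat (2 * k + 2) / 2 + s + 1) / (Gamma (of_nat (2 * k + 2) / 2) * Gamma (s + 1))
     = pochhammer (s + 1) (k + 1) / fact k"
  proof -
    have "s + 1 \<notin> \<int>\<^sub>\<le>\<^sub>0"
      using assms(1) by (auto elim!: nonpos_Ints_cases simp: complex_eq_iff)
    hence "pochhammer (s + 1) (k + 1) = Gamma (s + 1 + of_nat (k + 1)) / Gamma (s + 1)"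
      by (rule pochhammer_Gamma)
    moreover have "Gamma (of_nat k + 1 :: complex) = fact k"
      using Gamma_fact[of k, where ?'a = complex] by (simp add: add.commute)
    ultimately show ?thesis
      unfolding half by (simp add: add_ac)
  qed
  ultimately show ?thesis
    unfolding I_integral_def I_rat_def P_def by simp
qed

text \<open>Identity theorem: the difference is zero or nonzero off a sparse set, and agreement on
  \<open>S\<close> excludes the latter. Equality at the remaining points follows from the normalised
  values, 0 at poles and the limit elsewhere.\<close>

lemma nicely_meromorphic_eqI:
  assumes f: "f nicely_meromorphic_on UNIV" and g: "g nicely_meromorphic_on UNIV"
    and eq: "\<And>s. s \<in> S \<Longrightarrow> f s = g s" and S: "open S" "S \<noteq> {}"
  shows "f = g"
proof
  fix z
  have mero: "f meromorphic_on UNIV" "g meromorphic_on UNIV"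
    using f g by (auto simp: nicely_meromorphic_on_def)
  hence "(\<lambda>s. f s - g s) meromorphic_on UNIV"
    by (intro meromorphic_intros)
  hence "(\<forall>\<^sub>\<approx>s\<in>UNIV. f s - g s = 0) \<or> (\<forall>\<^sub>\<approx>s\<in>UNIV. f s - g s \<noteq> 0)"
    by (rule meromorphic_imp_constant_or_avoid) auto
  moreover have "\<not> (\<forall>\<^sub>\<approx>s\<in>UNIV. f s - g s \<noteq> 0)"
  proof
    assume *: "\<forall>\<^sub>\<approx>s\<in>UNIV. f s - g s \<noteq> 0"
    obtain w where w: "w \<in> S" using S by auto
    have "eventually (\<lambda>s. f s \<noteq> g s) (at w)"
      using * by (auto simp: eventually_cosparse_open_eq)
    moreover have "eventually (\<lambda>s. s \<in> S) (at w)"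
      using S w by (simp add: eventually_at_in_open')
    ultimately have "eventually (\<lambda>s. False) (at w)"
      by eventually_elim (use eq in auto)
    thus False by simp
  qed
  ultimately have "\<forall>\<^sub>\<approx>s\<in>UNIV. f s - g s = 0"
    by blast
  hence ev: "eventually (\<lambda>s. f s = g s) (at z)"
    by (auto simp: eventually_cosparse_open_eq)
  hence pole: "is_pole f z \<longleftrightarrow> is_pole g z"
    by (intro is_pole_cong) auto
  have lim: "f \<midarrow>z\<rightarrow> c \<longleftrightarrow> g \<midarrow>z\<rightarrow> c" for c
    by (intro tendsto_cong ev)
  show "f z = g z"
  proof (cases "is_pole f z")
    case True
    thus ?thesis
      using pole f g
      by (metis LIM_unique UNIV_I at_neq_bot is_pole_def nicely_meromorphic_on_def not_tendsto_and_filterlim_at_infinity)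
  next
    case False
    thus ?thesis
      using pole f g lim unfolding nicely_meromorphic_on_def by (metis LIM_unique UNIV_I)
  qed
qed

lemma I_rat_meromorphic: "I_rat k m meromorphic_on UNIV"
  unfolding I_rat_def pochhammer_prod by (intro meromorphic_intros)

lemma I_fun_eq:
  assumes "m + k > 0"
  shows "I_fun (2 * k + 2) m = remove_sings (I_rat k m)"
  unfolding I_fun_def
proof (rule the_equality)
  \<comment> \<open>Analyticity on the half-plane ensures that \<open>remove_sings\<close> leaves
    the values there unchanged.\<close>
  have ana: "I_rat k m analytic_on {s}" if "Re s > -1" for s
  proof -
    have "s + of_nat j + 1 \<noteq> 0" for j
      using that by (auto simp: complex_eq_iff)
    thus ?thesis
      unfolding I_rat_def pochhammer_prod by (intro analytic_intros) auto
  qed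
  show *: "remove_sings (I_rat k m) nicely_meromorphic_on UNIV \<and>
      (\<forall>s. Re s > -1 \<longrightarrow> remove_sings (I_rat k m) s = I_integral (2 * k + 2) m s)"
    using assms
    by (auto simp: I_rat_meromorphic ana simp del: mult_Suc_right add_2_eq_Suc' intro!: remove_sings_nicely_meromorphic
        I_integral_eq_rat[symmetric])
  fix f assume f: "f nicely_meromorphic_on UNIV \<and> (\<forall>s. Re s > -1 \<longrightarrow> f s = I_integral (2 * k + 2) m s)"
  show "f = remove_sings (I_rat k m)"
  proof (rule nicely_meromorphic_eqI)
    show "open {s. Re s > -1}"
      by (rule open_halfspace_Re_gt)
    show "{s. Re s > -1} \<noteq> {}"
      by (auto intro!: exI[of _ 0])
  qed (use f * in auto)
qed

text \<open>The factor \<open>s - s0\<close> cancels the one singular summand, and the rest is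
  evaluated at \<open>s0\<close>. For \<open>i \<le> k\<close> the Pochhammer factor vanishes and
  the limit is 0.\<close>

lemma I_fun_limit:
  fixes i :: nat
  assumes "m + k > 0"
  defines "s0 \<equiv> - of_nat i - 1"
  defines "r \<equiv> complex_of_real (W_coeff k m i * pochhammer (- real i) (k + 1) / fact k)"
  shows "((\<lambda>s. (s - s0) * I_fun (2 * k + 2) m s) \<longlongrightarrow> r) (at s0)"
proof -
  define d where "d = degree (W_poly k m \<circ>\<^sub>p [:1, -1:])"
  define c where "c j = complex_of_real (W_coeff k m j)" for j
  define G where "G s = pochhammer (s + 1) (k + 1) / fact k *
     (c i + (s - s0) * (\<Sum>j\<in>{..d} - {i}. c j / (s + of_nat j + 1)))" for s
  have ev: "eventually (\<lambda>s. (s - s0) * I_fun (2 * k + 2) m s = G s) (at s0)"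
  proof -
    have "isolated_singularity_at (I_rat k m) s0"
      using I_rat_meromorphic meromorphic_on_isolated_singularity meromorphic_on_subset by blast
    hence "eventually (\<lambda>s. remove_sings (I_rat k m) s = I_rat k m s) (at s0)"
      by (rule eventually_remove_sings_eq_at)
    moreover have "eventually (\<lambda>s. s \<noteq> s0) (at s0)"
      by (simp add: eventually_at_filter)
    ultimately show ?thesis
    proof eventually_elim
      case (elim s)
      have "(s - s0) * (\<Sum>j\<le>d. c j / (s + of_nat j + 1)) = c i + (s - s0) * (\<Sum>j\<in>{..d} - {i}. c j / (s + of_nat j + 1))"
      proof (cases "i \<le> d")
        case True
        have "s + of_nat i + 1 = s - s0"
          by (simp add: s0_def)
        thus ?thesis
          using True elim by (subst sum.remove[of _ i]) (simp_all only: finite_atMost atMost_iff distrib_left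
              times_divide_eq_right nonzero_mult_div_cancel_left right_minus_eq not_False_eq_True)
      next
        \<comment> \<open>Beyond the degree there is no summand with index \<open>i\<close>, but
          then \<open>c i = 0\<close>.\<close>
        case False
        hence "c i = 0"
          by (simp add: c_def W_coeff_def d_def coeff_eq_0)
        thus ?thesis
          using False by simp
      qed
      note eq = this
      show ?case
        unfolding I_fun_eq[OF assms(1)] elim(1) I_rat_def G_def c_def[symmetric] d_def[symmetric] eq[symmetric]
        by (simp only: mult_ac)
    qed
  qed
  have nz: "s0 + of_nat j + 1 \<noteq> 0" if "j \<noteq> i" for j
    using that by (auto simp: s0_def)
  have "isCont G s0"
    unfolding G_def pochhammer_prod using nz by (intro continuous_intros) auto
  hence "(G \<longlongrightarrow> G s0) (at s0)"
    by (simp add: isCont_def)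
  moreover have "pochhammer (- of_nat i) (k + 1) = complex_of_real (pochhammer (- real i) (k + 1))"
    by (simp flip: pochhammer_of_real)
  hence "G s0 = r"
    by (simp add: G_def r_def s0_def c_def)
  ultimately have "(G \<longlongrightarrow> r) (at s0)"
    by simp
  thus ?thesis
    using ev by (simp add: tendsto_cong)
qed

text \<open>The limit is the residue, that is, the Laurent coefficient at index \<open>-1\<close>;
  if it is nonzero, the expansion has negative order and there is a pole.\<close>

lemma laurent_coeff_eq:
  fixes i :: nat
  assumes "m + k > 0"
  defines "r \<equiv> complex_of_real (W_coeff k m i * pochhammer (- real i) (k + 1) / fact k)"
  shows "laurent_coeff (2 * k + 2) 1 m (- of_nat i - 1) = r"
    and "r \<noteq> 0 \<Longrightarrow> is_pole (I_fun (2 * k + 2) m) (- of_nat i - 1)"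
proof -
  define s0 :: complex where "s0 = - of_nat i - 1"
  let ?f = "I_fun (2 * k + 2) m"
  have mero: "?f meromorphic_on {s0}"
    using assms(1) I_rat_meromorphic meromorphic_on_subset remove_sings_meromorphic by (metis I_fun_eq subset_UNIV)
  have L: "(\<lambda>w. ?f (s0 + w)) has_laurent_expansion laurent_expansion ?f s0"
    by (rule meromorphic_on_imp_has_laurent_expansion[OF mero]) simp
  obtain A where A: "open A" "s0 \<in> A" "?f holomorphic_on A - {s0}"
    using meromorphic_on_isolated_singularity[OF mero]
    by (metis analytic_imp_holomorphic isolated_singularity_at_iff_analytic_nhd)
  have res: "residue ?f s0 = r"
    using I_fun_limit[OF assms(1), of i] by (intro residue_simple'[OF A]) (simp add: s0_def r_def mult.commute)
  thus 1: "laurent_coeff (2 * k + 2) 1 m (- of_nat i - 1) = r"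
    using has_laurent_expansion_residue[OF L] by (simp add: laurent_coeff_def s0_def)
  show "is_pole ?f (- of_nat i - 1)" if "r \<noteq> 0"
  proof -
    have "fls_subdegree (laurent_expansion ?f s0) < 0"
      using 1 that by (intro le_less_trans[OF fls_subdegree_leI[of _ "- 1"]]) (auto simp: laurent_coeff_def s0_def)
    thus ?thesis
      using has_laurent_expansion_imp_is_pole[OF L] by (simp add: s0_def)
  qed
qed

section \<open>Signs of the residues and the discrete Wallach set\<close>

lemma residue_top_nonpos:
  assumes "k \<ge> 1"
  shows "W_coeff k m (2 * k) * pochhammer (- real (2 * k)) (k + 1) / fact k \<le> 0"
    and "m > 0 \<Longrightarrow> W_coeff k m (2 * k) * pochhammer (- real (2 * k)) (k + 1) / fact k \<noteq> 0"
proof -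
  have "pochhammer (real m) i \<ge> 0" for i
    by (simp add: pochhammer_of_nat)
  thus "W_coeff k m (2 * k) * pochhammer (- real (2 * k)) (k + 1) / fact k \<le> 0"
    unfolding residue_top[OF assms] neg_le_0_iff_le by (intro divide_nonneg_nonneg mult_nonneg_nonneg) auto
  show "W_coeff k m (2 * k) * pochhammer (- real (2 * k)) (k + 1) / fact k \<noteq> 0" if "m > 0"
    using that assms unfolding residue_top[OF assms] by (auto simp: pochhammer_eq_0_iff add_eq_0_iff)
qed

lemma residue_second_nonpos:
  assumes "k \<ge> 2"
  shows "W_coeff k m (2 * k - 1) * pochhammer (- real (2 * k - 1)) (k + 1) / fact k \<le> 0"
    and "m > 0 \<Longrightarrow> W_coeff k m (2 * k - 1) * pochhammer (- real (2 * k - 1)) (k + 1) / fact k \<noteq> 0"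
proof -
  have "pochhammer (real m) i \<ge> 0" for i
    by (simp add: pochhammer_of_nat)
  thus "W_coeff k m (2 * k - 1) * pochhammer (- real (2 * k - 1)) (k + 1) / fact k \<le> 0"
    unfolding residue_second[OF assms] neg_le_0_iff_le using assms
    by (intro divide_nonneg_nonneg mult_nonneg_nonneg) auto
  show "W_coeff k m (2 * k - 1) * pochhammer (- real (2 * k - 1)) (k + 1) / fact k \<noteq> 0" if "m > 0"
    using that assms unfolding residue_second[OF assms] by (auto simp: pochhammer_eq_0_iff add_eq_0_iff)
qed

text \<open>The witness is \<open>m = 1\<close> because both residues in question vanish at
  \<open>m = 0\<close>.\<close>

lemma in_discrete_Wallach:
  assumes "k \<ge> 1"
    and nonpos: "\<And>m. W_coeff k m i * pochhammer (- real i) (k + 1) / fact k \<le> 0"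
    and nonzero: "W_coeff k 1 i * pochhammer (- real i) (k + 1) / fact k \<noteq> 0"
  shows "- of_nat i - 1 \<in> discrete_Wallach (2 * k + 2) 1"
proof -
  have mk: "m + k > 0" for m
    using assms by simp
  have "laurent_coeff (2 * k + 2) 1 m (- of_nat i - 1) \<in> \<real>\<^sub>\<le>\<^sub>0" for m
    unfolding laurent_coeff_eq(1)[OF mk] using nonpos by (intro nonpos_Reals_of_real_iff[THEN iffD2])
  moreover have "laurent_coeff (2 * k + 2) 1 1 (- of_nat i - 1) \<noteq> 0"
    unfolding laurent_coeff_eq(1)[OF mk] using nonzero by (simp only: of_real_eq_0_iff not_False_eq_True)
  moreover have "is_pole (I_fun (2 * k + 2) 1) (- of_nat i - 1)"
    using nonzero by (intro laurent_coeff_eq(2)[OF mk]) (simp only: of_real_eq_0_iff not_False_eq_True)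
  ultimately show ?thesis
    unfolding discrete_Wallach_def by blast
qed

text \<open>Both sides equal \<open>(2k+m)! / ((2k)! (m-1)!)\<close>.\<close>

lemma pochhammer_split_fact:
  assumes "m > 0"
  shows "pochhammer (real m) (2 * k + 1) / fact (2 * k) = pochhammer (2 * real k + 1) m / Gamma (real m)"
proof -
  obtain l where m: "m = Suc l"
    using assms by (cases m) auto
  have "pochhammer (2 * real k + 1) m = fact (2 * k + m) / fact (2 * k)"
    using pochhammer_nat_plus_1[of "2 * k" m] by simp
  moreover have "pochhammer (real m) (2 * k + 1) = fact (2 * k + m) / fact l"
    using pochhammer_nat_plus_1[of l "2 * k + 1"] by (simp add: m add_ac)
  moreover have "Gamma (real m) = fact l"
    using Gamma_fact[of l, where ?'a = real] by (simp add: m add_ac)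
  ultimately show ?thesis
    by simp
qed

lemma limit_top:
  assumes "k \<ge> 1" "m > 0"
  shows "complex_of_real (W_coeff k m (2 * k) * pochhammer (- real (2 * k)) (k + 1) / fact k) =
    - (pochhammer (2 * of_nat k + 1) m / Gamma (of_nat m) *
        (pochhammer (of_nat k) m / pochhammer (of_nat k + 1) m))"
proof -
  have "pochhammer (real k) m / pochhammer (real k + 1) m = real k / (real m + real k)"
  proof -
    have "pochhammer (real k) m * (real k + real m) = real k * pochhammer (real k + 1) m"
      using pochhammer_Suc[of "real k" m] pochhammer_rec[of "real k" m] by simp
    moreover have "pochhammer (real k + 1) m \<noteq> 0" "real m + real k \<noteq> 0"
      using assms by (simp_all add: pochhammer_eq_0_iff add_eq_0_iff)
    ultimately show ?thesis
      by (simp add: field_simps)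
  qed
  hence eq: "W_coeff k m (2 * k) * pochhammer (- real (2 * k)) (k + 1) / fact k =
     - (pochhammer (2 * real k + 1) m / Gamma (real m) * (pochhammer (real k) m / pochhammer (real k + 1) m))"
    unfolding residue_top[OF assms(1)] pochhammer_split_fact[OF assms(2), symmetric] by simp
  show ?thesis
    unfolding eq by (simp flip: pochhammer_of_real Gamma_complex_of_real)
qed

lemma limit_second:
  assumes "k \<ge> 2" "m > 0"
  shows "complex_of_real (W_coeff k m (2 * k - 1) * pochhammer (- real (2 * k - 1)) (k + 1) / fact k) =
    - (pochhammer (2 * of_nat k + 1) m / pochhammer 2 m *
        (of_nat m * (of_nat m + 1) * of_nat k * (of_nat k + 1) * (of_nat k - 1) /
          ((of_nat m + of_nat k - 1) * (of_nat m + of_nat k) * (of_nat m + of_nat k + 1))))"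
proof -
  obtain l where m: "m = Suc l"
    using assms by (cases m) auto
  \<comment> \<open>This uses \<open>(2)_m = (m+1)!\<close> and
    \<open>Gamma m = (m-1)!\<close>.\<close>
  have G: "1 / Gamma (real m) = real m * (real m + 1) / pochhammer 2 m"
  proof -
    have "pochhammer 2 m = (fact (m + 1) :: real)"
      using pochhammer_nat_plus_1[of 1 m] by simp
    moreover have "Gamma (real m) = fact l"
      using Gamma_fact[of l, where ?'a = real] by (simp add: m add_ac)
    moreover have "fact (m + 1) = (real m + 1) * (real m * fact l)"
      by (simp add: m)
    moreover have "real m + 1 \<noteq> 0" "real m \<noteq> 0"
      by (simp_all add: m add_eq_0_iff)
    ultimately show ?thesis
      by simp
  qed
  have "W_coeff k m (2 * k - 1) * pochhammer (- real (2 * k - 1)) (k + 1) / fact k =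
     - ((pochhammer (real m) (2 * k + 1) / fact (2 * k)) * (real k * (real k + 1) * (real k - 1)
      / ((real m + real k - 1) * (real m + real k) * (real m + real k + 1))))"
    unfolding residue_second[OF assms(1)] by (simp add: mult_ac)
  also have "\<dots> = - (pochhammer (2 * real k + 1) m * (1 / Gamma (real m)) * (real k * (real k + 1) * (real k - 1)
      / ((real m + real k - 1) * (real m + real k) * (real m + real k + 1))))"
    unfolding pochhammer_split_fact[OF assms(2)] by simp
  finally have eq: "W_coeff k m (2 * k - 1) * pochhammer (- real (2 * k - 1)) (k + 1) / fact k =
     - (pochhammer (2 * real k + 1) m / pochhammer 2 m * (real m * (real m + 1) * real k * (real k + 1) * (real k - 1)
      / ((real m + real k - 1) * (real m + real k) * (real m + real k + 1))))"
    unfolding G by (simp add: mult_ac)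
  show ?thesis
    unfolding eq by (simp flip: pochhammer_of_real)
qed

text \<open>The result in terms of \<open>k\<close>, with \<open>n = 2 k + 2\<close>, which avoids
  halves: the points are \<open>- n + 1\<close> and \<open>- n + 2\<close>. The case
  \<open>k = 1\<close> supplies the claim for dimension 4.\<close>

lemma poles_even_dimension:
  fixes k :: nat
  assumes "k \<ge> 1"
  shows "(\<forall>m>0. ((\<lambda>s. (s - (- of_nat (2 * k) - 1)) * I_fun (2 * k + 2) m s) \<longlongrightarrow>
           - (pochhammer (2 * of_nat k + 1) m / Gamma (of_nat m) *
              (pochhammer (of_nat k) m / pochhammer (of_nat k + 1) m))) (at (- of_nat (2 * k) - 1))) \<and>
    - of_nat (2 * k) - 1 \<in> discrete_Wallach (2 * k + 2) 1 \<and>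
    (k \<ge> 2 \<longrightarrow> (\<forall>m>0. ((\<lambda>s. (s - (- of_nat (2 * k - 1) - 1)) * I_fun (2 * k + 2) m s) \<longlongrightarrow>
           - (pochhammer (2 * of_nat k + 1) m / pochhammer 2 m *
              (of_nat m * (of_nat m + 1) * of_nat k * (of_nat k + 1) * (of_nat k - 1) /
               ((of_nat m + of_nat k - 1) * (of_nat m + of_nat k) * (of_nat m + of_nat k + 1)))))
         (at (- of_nat (2 * k - 1) - 1))) \<and>
      - of_nat (2 * k - 1) - 1 \<in> discrete_Wallach (2 * k + 2) 1)"
proof (intro conjI allI impI)
  fix m :: nat assume m: "m > 0"
  hence mk: "m + k > 0"
    by simp
  show "((\<lambda>s. (s - (- of_nat (2 * k) - 1)) * I_fun (2 * k + 2) m s) \<longlongrightarrow>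
           - (pochhammer (2 * of_nat k + 1) m / Gamma (of_nat m) *
              (pochhammer (of_nat k) m / pochhammer (of_nat k + 1) m))) (at (- of_nat (2 * k) - 1))"
    using I_fun_limit[OF mk, of "2 * k"] unfolding limit_top[OF assms m] .
  assume k: "k \<ge> 2"
  show "((\<lambda>s. (s - (- of_nat (2 * k - 1) - 1)) * I_fun (2 * k + 2) m s) \<longlongrightarrow>
           - (pochhammer (2 * of_nat k + 1) m / pochhammer 2 m *
              (of_nat m * (of_nat m + 1) * of_nat k * (of_nat k + 1) * (of_nat k - 1) /
               ((of_nat m + of_nat k - 1) * (of_nat m + of_nat k) * (of_nat m + of_nat k + 1)))))
         (at (- of_nat (2 * k - 1) - 1))"
    using I_fun_limit[OF mk, of "2 * k - 1"] unfolding limit_second[OF k m] .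
next
  show "- of_nat (2 * k) - 1 \<in> discrete_Wallach (2 * k + 2) 1"
    by (intro in_discrete_Wallach residue_top_nonpos assms) simp
next
  assume "k \<ge> 2"
  thus "- of_nat (2 * k - 1) - 1 \<in> discrete_Wallach (2 * k + 2) 1"
    by (intro in_discrete_Wallach residue_second_nonpos assms) simp_all
qed

theorem theorem4p1:
  shows "(\<forall>n::nat. n \<ge> 6 \<and> even n \<longrightarrow>
      (\<forall>m::nat. m \<ge> 1 \<longrightarrow>
        ((\<lambda>s::complex. (s + of_nat n - 1) * I_fun n m s) \<longlongrightarrow>
           - (pochhammer (of_nat n - 1) m / Gamma (of_nat m) *
              (pochhammer (of_nat n / 2 - 1) m / pochhammer (of_nat n / 2) m)))
          (at (- of_nat n + 1)) \<and>
        ((\<lambda>s::complex. (s + of_nat n - 2) * I_fun n m s) \<longlongrightarrow>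
           - (pochhammer (of_nat n - 1) m / pochhammer 2 m *
              (of_nat m * (of_nat m + 1) * of_nat n * (of_nat n / 2 - 1) * (of_nat n / 2 - 2) /
               (2 * (of_nat m + of_nat n / 2 - 2) * (of_nat m + of_nat n / 2 - 1) *
                (of_nat m + of_nat n / 2)))))
          (at (- of_nat n + 2))) \<and>
      - of_nat n + 1 \<in> discrete_Wallach n 1 \<and>
      - of_nat n + 2 \<in> discrete_Wallach n 1) \<and>
    - 3 \<in> discrete_Wallach 4 1"
proof (intro conjI allI impI)
  show "- 3 \<in> discrete_Wallach 4 1"
    using poles_even_dimension[of 1] by simp
  fix n :: nat
  assume n: "n \<ge> 6 \<and> even n"
  define k where "k = n div 2 - 1"
  have n_eq: "n = 2 * k + 2" and k: "k \<ge> 2"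
    using n by (auto simp: k_def)
  have "k \<ge> 1"
    using k by simp
  note poles = poles_even_dimension[OF this]
  have s0: "- of_nat (2 * k) - 1 = (- of_nat n + 1 :: complex)" "- of_nat (2 * k - 1) - 1 = (- of_nat n + 2 :: complex)"
    using k by (simp_all add: n_eq of_nat_diff)
  have shift: "s - (- of_nat n + 1) = s + of_nat n - 1" "s - (- of_nat n + 2) = s + of_nat n - 2" for s :: complex
    by simp_all
  show "- of_nat n + 1 \<in> discrete_Wallach n 1" "- of_nat n + 2 \<in> discrete_Wallach n 1"
    using poles k unfolding s0 n_eq[symmetric] by simp_all
  fix m :: nat
  assume "m \<ge> 1"
  hence m: "m > 0"
    by simp
  have half: "of_nat n / 2 = (of_nat k + 1 :: complex)"
    by (simp add: n_eq field_simps)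
  have n_eq': "of_nat n = (2 * (of_nat k + 1) :: complex)"
    by (simp add: n_eq)
  have "2 * of_nat k + 1 = (of_nat n - 1 :: complex)" "of_nat k = (of_nat n / 2 - 1 :: complex)"
      "of_nat k + 1 = (of_nat n / 2 :: complex)"
    unfolding half by (simp_all add: n_eq')
  hence top: "- (pochhammer (2 * of_nat k + 1) m / Gamma (of_nat m) * (pochhammer (of_nat k) m / pochhammer (of_nat k + 1) m))
      = - (pochhammer (of_nat n - 1) m / Gamma (of_nat m) *
           (pochhammer (of_nat n / 2 - 1) m / pochhammer (of_nat n / 2) m) :: complex)"
    by (simp only:)
  have second: "- (pochhammer (2 * of_nat k + 1) m / pochhammer 2 m *
              (of_nat m * (of_nat m + 1) * of_nat k * (of_nat k + 1) * (of_nat k - 1) /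
               ((of_nat m + of_nat k - 1) * (of_nat m + of_nat k) * (of_nat m + of_nat k + 1))))
      = - (pochhammer (of_nat n - 1) m / pochhammer 2 m *
              (of_nat m * (of_nat m + 1) * of_nat n * (of_nat n / 2 - 1) * (of_nat n / 2 - 2) /
               (2 * (of_nat m + of_nat n / 2 - 2) * (of_nat m + of_nat n / 2 - 1) *
                (of_nat m + of_nat n / 2))) :: complex)"
  proof -
    have half: "2 * (z + 1) / 2 = z + 1" "2 * (z + 1) - 1 = 2 * z + 1" "z + 1 - 1 = z" "z + 1 - 2 = z - 1"
        "w + (z + 1) = w + z + 1" "w + z + 1 - 2 = w + z - 1" for w z :: complex
      by simp_all
    \<comment> \<open>The factor \<open>n\<close> of the numerator is \<open>2 (k + 1)\<close>; its
      2 cancels the one in the denominator.\<close>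
    have cancel: "a * b * (2 * c) * d * e / (2 * u * v * w) = a * b * d * c * e / (u * v * w)"
      for a b c d e u v w :: complex
      by (simp add: mult_ac)
    have "- (pochhammer (2 * of_nat k + 1) m / pochhammer 2 m *
              (of_nat m * (of_nat m + 1) * of_nat k * (of_nat k + 1) * (of_nat k - 1) /
               ((of_nat m + of_nat k - 1) * (of_nat m + of_nat k) * (of_nat m + of_nat k + 1))))
      = - (pochhammer (2 * (of_nat k + 1) - 1) m / pochhammer 2 m *
              (of_nat m * (of_nat m + 1) * (2 * (of_nat k + 1)) * (2 * (of_nat k + 1) / 2 - 1) * (2 * (of_nat k + 1) / 2 - 2) /
               (2 * (of_nat m + 2 * (of_nat k + 1) / 2 - 2) * (of_nat m + 2 * (of_nat k + 1) / 2 - 1) *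
                (of_nat m + 2 * (of_nat k + 1) / 2))) :: complex)"
      unfolding half cancel ..
    also have "2 * (of_nat k + 1) = (of_nat n :: complex)"
      by (simp add: n_eq)
    finally show ?thesis .
  qed
  show "((\<lambda>s::complex. (s + of_nat n - 1) * I_fun n m s) \<longlongrightarrow>
           - (pochhammer (of_nat n - 1) m / Gamma (of_nat m) *
              (pochhammer (of_nat n / 2 - 1) m / pochhammer (of_nat n / 2) m)))
          (at (- of_nat n + 1))"
    using poles[THEN conjunct1, rule_format, OF m] unfolding top s0 shift n_eq[symmetric] .
  show "((\<lambda>s::complex. (s + of_nat n - 2) * I_fun n m s) \<longlongrightarrow>
           - (pochhammer (of_nat n - 1) m / pochhammer 2 m *
              (of_nat m * (of_nat m + 1) * of_nat n * (of_nat n / 2 - 1) * (of_nat n / 2 - 2) /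
               (2 * (of_nat m + of_nat n / 2 - 2) * (of_nat m + of_nat n / 2 - 1) *
                (of_nat m + of_nat n / 2)))))
          (at (- of_nat n + 2))"
    using poles[THEN conjunct2, THEN conjunct2, rule_format, OF k, THEN conjunct1, rule_format, OF m]
    unfolding second s0 shift n_eq[symmetric] .
qed

end
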